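(* Let $g\ge1$, let $C\subseteq\mathbb{F}_2^n$ be a Type II code and let $T\subseteq[n]$. Then the genus-$g$ Jacobi polynomial $J_{C,T}^{(g)}$ is invariant under the action of the group $G_g\subseteq\mathrm{GL}(2^{g+1},\mathbb{C})$, i.e. $\tau J_{C,T}^{(g)}=J_{C,T}^{(g)}$ for all $\tau\in G_g$.
   Context: A binary linear code $C\subseteq\mathbb{F}_2^n$ is Type II if $C=C^\perp$ (dual with respect to the standard inner product) and every codeword has weight divisible by $4$. $[n]=\{1,\dots,n\}$. For $u_1,\dots,u_g\in C$, $a\in\mathbb{F}_2^g$ and $X\subseteq[n]$, let $n_{a,X}(u_1,\dots,u_g)$ be the number of $i\in X$ with $(u_{1i},\dots,u_{gi})=a$. The genus-$g$ Jacobi polynomial is \[J_{C,T}^{(g)}=\sum_{u_1,\dots,u_g\in C}\prod_{a\in\mathbb{F}_2^g}y_a^{n_{a,T}(u_1,\dots,u_g)}x_a^{n_{a,[n]\setminus T}(u_1,\dots,u_g)}.\] A matrix $\tau\in\mathrm{GL}(2^{g+1},\mathbb{C})$ acts on polynomials $f$ in the $2^{g+1}$ variables arranged as the column vector $v=((x_a)_{a\in\mathbb{F}_2^g},(y_a)_{a\in\mathbb{F}_2^g})$ (each block indexed by $\mathbb{F}_2^g$ in lexicographic order) by $(\tau f)(v)=f(\tau v)$. Define $2^g\times2^g$ matrices $T_g=\left(\frac{1+i}{2}\right)^g\big((-1)^{a\cdot b}\big)_{a,b\in\mathbb{F}_2^g}$ and $E_g=\mathrm{diag}(1,i,1,i,\dots)$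 (the diagonal entry at $a=(a_1,\dots,a_g)$ being $i^{a_g}$). For $\sigma=(w,M)\in\mathbb{F}_2^g\rtimes\mathrm{GL}(g,\mathbb{F}_2)$ acting on $\mathbb{F}_2^g$ by $\sigma(a)=Ma+w$, let $M_g(\sigma)$ be the $(0,1)$-matrix with nonzero entries exactly at positions $(a,\sigma(a))$, $a\in\mathbb{F}_2^g$. Let $\widetilde T_g,\widetilde E_g,\widetilde M_g(\sigma)$ be the block-diagonal $2^{g+1}\times2^{g+1}$ matrices with two copies of $T_g$, $E_g$, $M_g(\sigma)$ respectively on the diagonal, and let $\eta_8=(1+i)/\sqrt2$ (acting as the scalar matrix $\eta_8 I$). Then $G_g=\langle \widetilde T_g,\widetilde E_g,\widetilde M_g(\sigma)\ (\sigma\in\mathbb{F}_2^g\rtimes\mathrm{GL}(g,\mathbb{F}_2)),\eta_8\rangle$. *)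

theory Defs
  imports
    Complex_Main
    "HOL-Library.Z2"
    "HOL-Library.FuncSet"
    "HOL-Library.Poly_Mapping"
    "HOL-Algebra.Generated_Groups"
    "Jordan_Normal_Form.Matrix"
    "Jordan_Normal_Form.VS_Connect"
begin

section \<open>Type II codes\<close>

text \<open>
  Coordinates are numbered from 0, so \<open>[n]\<close> is rendered as \<open>{..<n}\<close>; likewise the entries
  \<open>a_1, \<dots>, a_g\<close> of a vector \<open>a\<close> over the field with two elements are
  \<open>a $ 0, \<dots>, a $ (g - 1)\<close>.
\<close>

definition linear_code :: "nat \<Rightarrow> bit vec set \<Rightarrow> bool" where
  "linear_code n C \<longleftrightarrow> VectorSpace.subspace class_ring C (module_vec TYPE(bit) n)"

definition dual_code :: "nat \<Rightarrow> bit vec set \<Rightarrow> bit vec set" where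
  "dual_code n C = {v \<in> carrier_vec n. \<forall>u \<in> C. u \<bullet> v = 0}"

definition weight :: "bit vec \<Rightarrow> nat" where
  "weight v = card {i. i < dim_vec v \<and> v $ i \<noteq> 0}"

definition type_II_code :: "nat \<Rightarrow> bit vec set \<Rightarrow> bool" where
  "type_II_code n C \<longleftrightarrow>
     linear_code n C \<and> C = dual_code n C \<and> (\<forall>u \<in> C. 4 dvd weight u)"

section \<open>Polynomials in the variables \<open>x_a\<close> and \<open>y_a\<close>\<close>

datatype jvar = X "bit vec" | Y "bit vec"

text \<open>
  A monomial is a finitely supported exponent function, a polynomial a finitely supported
  function from monomials to coefficients; multiplication is the convolution product of
  \<^theory>\<open>HOL-Library.Poly_Mapping\<close>.
\<close>

type_synonym jpoly = "(jvar \<Rightarrow>\<^sub>0 nat) \<Rightarrow>\<^sub>0 complex"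

definition Const :: "complex \<Rightarrow> jpoly" where
  "Const c = Poly_Mapping.single 0 c"

definition Var :: "jvar \<Rightarrow> jpoly" where
  "Var z = Poly_Mapping.single (Poly_Mapping.single z 1) 1"

definition subst_poly :: "(jvar \<Rightarrow> jpoly) \<Rightarrow> jpoly \<Rightarrow> jpoly" where
  "subst_poly s f =
     (\<Sum>m \<in> Poly_Mapping.keys f.
        Const (Poly_Mapping.lookup f m) *
        (\<Prod>z \<in> Poly_Mapping.keys m. s z ^ Poly_Mapping.lookup m z))"

section \<open>Jacobi polynomials\<close>

text \<open>A \<open>g\<close>-tuple of codewords is a function \<open>u\<close> on \<open>{..<g}\<close>.\<close>

definition col_count :: "nat \<Rightarrow> bit vec \<Rightarrow> nat set \<Rightarrow> (nat \<Rightarrow> bit vec) \<Rightarrow> nat" where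
  "col_count g a S u = card {i \<in> S. vec g (\<lambda>j. u j $ i) = a}"

definition jacobi_poly :: "nat \<Rightarrow> nat \<Rightarrow> bit vec set \<Rightarrow> nat set \<Rightarrow> jpoly" where
  "jacobi_poly g n C T =
     (\<Sum>u \<in> {..<g} \<rightarrow>\<^sub>E C. \<Prod>a \<in> carrier_vec g.
        Var (Y a) ^ col_count g a T u * Var (X a) ^ col_count g a ({..<n} - T) u)"

section \<open>Lexicographic order and the action of matrices on polynomials\<close>

text \<open>
  In the lexicographic order with \<open>0 < 1\<close> the position of \<open>a\<close> is the number with binary digits
  \<open>a_1 \<dots> a_g\<close>, the most significant digit being \<open>a_1\<close>. Thus \<open>lex_vec g k\<close>, for
  \<open>k < 2 ^ g\<close>, is the \<open>k\<close>-th vector (counting from 0), and \<open>lex_pos g\<close> is the inverse map.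
\<close>

definition lex_vec :: "nat \<Rightarrow> nat \<Rightarrow> bit vec" where
  "lex_vec g k = vec g (\<lambda>j. of_nat (k div 2 ^ (g - 1 - j)))"

definition lex_pos :: "nat \<Rightarrow> bit vec \<Rightarrow> nat" where
  "lex_pos g a = (\<Sum>j<g. of_bit (a $ j) * 2 ^ (g - 1 - j))"

definition var_vec :: "nat \<Rightarrow> jpoly vec" where
  "var_vec g =
     vec (2 ^ g) (\<lambda>k. Var (X (lex_vec g k))) @\<^sub>v vec (2 ^ g) (\<lambda>k. Var (Y (lex_vec g k)))"

fun var_pos :: "nat \<Rightarrow> jvar \<Rightarrow> nat" where
  "var_pos g (X a) = lex_pos g a"
| "var_pos g (Y a) = 2 ^ g + lex_pos g a"

text \<open>
  \<open>(\<tau> f)(v) = f(\<tau> v)\<close>: each variable is replaced by the corresponding entry of \<open>\<tau> v\<close>.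
  Only polynomials in the variables with index in \<open>carrier_vec g\<close> are of interest; what
  happens to the remaining elements of \<^typ>\<open>jvar\<close> is irrelevant.
\<close>

definition act :: "nat \<Rightarrow> complex mat \<Rightarrow> jpoly \<Rightarrow> jpoly" where
  "act g \<tau> f = subst_poly (\<lambda>z. (map_mat Const \<tau> *\<^sub>v var_vec g) $ var_pos g z) f"

section \<open>The group\<close>

definition GL :: "'a::field itself \<Rightarrow> nat \<Rightarrow> 'a mat monoid" where
  "GL ty N = units_of (ring_mat ty N ())"

definition T_mat :: "nat \<Rightarrow> complex mat" where
  "T_mat g = ((1 + \<i>) / 2) ^ g \<cdot>\<^sub>m
     mat (2 ^ g) (2 ^ g) (\<lambda>(k, l). if lex_vec g k \<bullet> lex_vec g l = 0 then 1 else - 1)"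

definition E_mat :: "nat \<Rightarrow> complex mat" where
  "E_mat g = mat (2 ^ g) (2 ^ g)
     (\<lambda>(k, l). if k = l then if lex_vec g k $ (g - 1) = 0 then 1 else \<i> else 0)"

definition affine_map :: "bit vec \<Rightarrow> bit mat \<Rightarrow> bit vec \<Rightarrow> bit vec" where
  "affine_map w M a = M *\<^sub>v a + w"

definition M_mat :: "nat \<Rightarrow> bit vec \<Rightarrow> bit mat \<Rightarrow> complex mat" where
  "M_mat g w M = mat (2 ^ g) (2 ^ g)
     (\<lambda>(k, l). if lex_vec g l = affine_map w M (lex_vec g k) then 1 else 0)"

definition two_copies :: "complex mat \<Rightarrow> complex mat" where
  "two_copies A =
     four_block_mat A (0\<^sub>m (dim_row A) (dim_col A)) (0\<^sub>m (dim_row A) (dim_col A)) A"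

definition eta8 :: complex where
  "eta8 = (1 + \<i>) / complex_of_real (sqrt 2)"

definition G_gens :: "nat \<Rightarrow> complex mat set" where
  "G_gens g =
     {two_copies (T_mat g), two_copies (E_mat g), eta8 \<cdot>\<^sub>m 1\<^sub>m (2 ^ (g + 1))} \<union>
     {two_copies (M_mat g w M) | w M. w \<in> carrier_vec g \<and> M \<in> carrier (GL TYPE(bit) g)}"

text \<open>
  \<^const>\<open>generate\<close> gives a subgroup only if the generators lie in the ambient group; this is
  checked in \<open>G_group_subgroup\<close> below.
\<close>

definition G_group :: "nat \<Rightarrow> complex mat set" where
  "G_group g = generate (GL TYPE(complex) (2 ^ (g + 1))) (G_gens g)"

section \<open>Well-formedness of the definitions\<close>

lemma binary_digits_sum: "(\<Sum>j<g. (k div 2 ^ j mod 2) * 2 ^ j) = k mod 2 ^ g" for k :: nat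
proof (induction g)
  case (Suc g)
  have "k mod (2 ^ g * 2) = 2 ^ g * (k div 2 ^ g mod 2) + k mod 2 ^ g"
    by (rule mod_mult2_eq)
  with Suc show ?case by (simp add: mult.commute)
qed simp

lemma of_bit_of_nat: "(of_bit (of_nat m :: bit) :: nat) = m mod 2"
  by (induction m) (auto simp: mod_Suc)

lemma lex_pos_lex_vec:
  assumes "k < 2 ^ g"
  shows "lex_pos g (lex_vec g k) = k"
proof -
  have "lex_pos g (lex_vec g k) = (\<Sum>j<g. (k div 2 ^ (g - 1 - j) mod 2) * 2 ^ (g - 1 - j))"
    unfolding lex_pos_def by (rule sum.cong) (simp_all only: lex_vec_def index_vec lessThan_iff of_bit_of_nat)
  also have "\<dots> = (\<Sum>j<g. (k div 2 ^ j mod 2) * 2 ^ j)"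
    using sum.nat_diff_reindex[of "\<lambda>j. (k div 2 ^ j mod 2) * 2 ^ j" g] by simp
  also have "\<dots> = k" using assms by (simp add: binary_digits_sum)
  finally show ?thesis .
qed

lemma card_carrier_vec_bit: "finite (carrier_vec g :: bit vec set)"
  "card (carrier_vec g :: bit vec set) = 2 ^ g"
proof -
  have U: "(UNIV :: bit set) = {0, 1}"
    using bit.exhaust by auto
  have b: "bij_betw (\<lambda>f. vec g f) ({..<g} \<rightarrow>\<^sub>E UNIV) (carrier_vec g :: bit vec set)"
  proof (rule bij_betwI[where g = "\<lambda>v. restrict (\<lambda>i. v $ i) {..<g}"])
    show "restrict (\<lambda>i. vec g f $ i) {..<g} = f"
      if "f \<in> {..<g} \<rightarrow>\<^sub>E (UNIV :: bit set)" for f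
      using that by (auto simp: fun_eq_iff PiE_def extensional_def)
  qed auto
  have f: "finite ({..<g} \<rightarrow>\<^sub>E (UNIV :: bit set))"
    by (intro finite_PiE) (auto simp: U)
  show "finite (carrier_vec g :: bit vec set)"
    using bij_betw_finite[OF b] f by simp
  show "card (carrier_vec g :: bit vec set) = 2 ^ g"
    using bij_betw_same_card[OF b] by (simp add: card_PiE U numeral_2_eq_2)
qed

lemma lex_vec_bij: "bij_betw (lex_vec g) {..<2 ^ g} (carrier_vec g)"
proof -
  have i: "inj_on (lex_vec g) {..<2 ^ g}"
    by (rule inj_on_inverseI[of _ "lex_pos g"]) (simp add: lex_pos_lex_vec)
  have s: "lex_vec g ` {..<2 ^ g} \<subseteq> carrier_vec g"
    by (auto simp: lex_vec_def)
  have "lex_vec g ` {..<2 ^ g} = carrier_vec g"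
    by (rule card_subset_eq) (use i s in \<open>auto simp: card_image card_carrier_vec_bit\<close>)
  with i show ?thesis by (simp add: bij_betw_def)
qed

lemma lex_vec_lex_pos:
  assumes "a \<in> carrier_vec g"
  shows "lex_vec g (lex_pos g a) = a" "lex_pos g a < 2 ^ g"
proof -
  obtain k where "k < 2 ^ g" "a = lex_vec g k"
    using assms lex_vec_bij[of g] by (auto simp: bij_betw_def)
  then show "lex_vec g (lex_pos g a) = a" "lex_pos g a < 2 ^ g"
    by (auto simp: lex_pos_lex_vec)
qed

lemma lex_vec_carrier [simp]: "lex_vec g k \<in> carrier_vec g"
  by (simp add: lex_vec_def)

lemma act_var:
  assumes "\<tau> \<in> carrier_mat (2 ^ (g + 1)) (2 ^ (g + 1))" "k < 2 ^ (g + 1)"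
  shows "act g \<tau> (var_vec g $ k) = (\<Sum>l<2 ^ (g + 1). Const (\<tau> $$ (k, l)) * var_vec g $ l)"
proof -
  obtain z where z: "var_vec g $ k = Var z" "var_pos g z = k"
  proof (cases "k < 2 ^ g")
    case True
    with that[of "X (lex_vec g k)"] show ?thesis
      by (simp add: var_vec_def lex_pos_lex_vec)
  next
    case False
    with assms(2) that[of "Y (lex_vec g (k - 2 ^ g))"] show ?thesis
      by (simp add: var_vec_def lex_pos_lex_vec)
  qed
  have d: "dim_vec (var_vec g) = 2 ^ (g + 1)" by (simp add: var_vec_def)
  have "act g \<tau> (Var z) = (map_mat Const \<tau> *\<^sub>v var_vec g) $ var_pos g z"
    by (simp add: act_def subst_poly_def Var_def Const_def Poly_Mapping.single_one)
  also have "\<dots> = (\<Sum>l<2 ^ (g + 1). Const (\<tau> $$ (k, l)) * var_vec g $ l)"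
    using assms z(2) d by (auto simp: scalar_prod_def lessThan_atLeast0 intro!: sum.cong)
  finally show ?thesis by (simp add: z(1))
qed

lemma GL_I:
  assumes "A \<in> carrier_mat N N" "B \<in> carrier_mat N N" "A * B = 1\<^sub>m N"
  shows "A \<in> carrier (GL TYPE('a::field) N)"
proof -
  have "B * A = 1\<^sub>m N" by (rule mat_mult_left_right_inverse[OF assms])
  with assms show ?thesis
    by (auto simp: GL_def units_of_def Units_def ring_mat_simps)
qed

lemma group_GL: "group (GL TYPE('a::field) N)"
proof -
  interpret ring "ring_mat TYPE('a) N ()" by (rule ring_mat)
  show ?thesis unfolding GL_def by (rule units_group)
qed

lemma two_copies_GL:
  assumes "A \<in> carrier_mat (2 ^ g) (2 ^ g)" "B \<in> carrier_mat (2 ^ g) (2 ^ g)" "A * B = 1\<^sub>m (2 ^ g)"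
  shows "two_copies A \<in> carrier (GL TYPE(complex) (2 ^ (g + 1)))"
proof (rule GL_I)
  have e: "(2::nat) ^ (g + 1) = 2 ^ g + 2 ^ g" by simp
  show "two_copies A \<in> carrier_mat (2 ^ (g + 1)) (2 ^ (g + 1))"
    "two_copies B \<in> carrier_mat (2 ^ (g + 1)) (2 ^ (g + 1))"
    unfolding two_copies_def e using assms by auto
  let ?Z = "0\<^sub>m (2 ^ g) (2 ^ g) :: complex mat"
  have Z: "?Z \<in> carrier_mat (2 ^ g) (2 ^ g)" by simp
  have "two_copies A * two_copies B = four_block_mat A ?Z ?Z A * four_block_mat B ?Z ?Z B"
    using assms by (auto simp: two_copies_def)
  also have "\<dots> = four_block_mat (1\<^sub>m (2 ^ g)) ?Z ?Z (1\<^sub>m (2 ^ g))"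
    by (subst mult_four_block_mat[OF assms(1) Z Z assms(1) assms(2) Z Z assms(2)])
      (use assms in simp)
  finally show "two_copies A * two_copies B = 1\<^sub>m (2 ^ (g + 1))" by (simp add: mult_2)
qed

lemma char_sum:
  assumes a: "a \<in> carrier_vec g" and b: "b \<in> carrier_vec g"
  shows "(\<Sum>v \<in> carrier_vec g. (if a \<bullet> v = (0::bit) then 1 else - 1) * (if v \<bullet> b = 0 then 1 else - 1)) =
    (if a = b then 2 ^ g else (0::complex))"
proof (cases "a = b")
  case True
  have "(if a \<bullet> v = 0 then 1 else - 1) * (if v \<bullet> b = 0 then 1 else - 1) = (1::complex)"
    if "v \<in> carrier_vec g" for v
    using comm_scalar_prod[OF b that] True by simp
  with True show ?thesis by (simp add: card_carrier_vec_bit)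
next
  case False
  then obtain j where j: "j < g" "a $ j \<noteq> b $ j" using a b by (metis eq_vecI carrier_vecD)
  let ?f = "\<lambda>v. (if a \<bullet> v = 0 then 1 else - 1) * (if v \<bullet> b = 0 then 1 else - 1) :: complex"
  let ?t = "\<lambda>v. v + unit_vec g j :: bit vec"
  have uu: "unit_vec g j + unit_vec g j = (0\<^sub>v g :: bit vec)"
    by (intro eq_vecI) auto
  have "(\<Sum>v \<in> carrier_vec g. ?f v) = (\<Sum>v \<in> carrier_vec g. ?f (?t v))"
    by (rule sum.reindex_bij_witness[where i = ?t and j = ?t]) (auto simp: uu)
  also have "\<dots> = (\<Sum>v \<in> carrier_vec g. - ?f v)"
  proof (rule sum.cong[OF refl])
    fix v :: "bit vec" assume v: "v \<in> carrier_vec g"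
    have 1: "a \<bullet> ?t v = a \<bullet> v + a $ j"
      using a v j(1) by (subst scalar_prod_add_distrib[of _ g]) auto
    have 2: "?t v \<bullet> b = v \<bullet> b + b $ j"
      using b v j(1) by (subst add_scalar_prod_distrib[of _ g]) auto
    show "?f (?t v) = - ?f v" unfolding 1 2 using j(2)
      by (cases "a \<bullet> v"; cases "v \<bullet> b"; cases "a $ j"; cases "b $ j") auto
  qed
  also have "\<dots> = - (\<Sum>v \<in> carrier_vec g. ?f v)" by (rule sum_negf)
  finally show ?thesis using False by simp
qed

lemma T_mat_inverse:
  "T_mat g * (((1 - \<i>) / 2) ^ g \<cdot>\<^sub>m
     mat (2 ^ g) (2 ^ g) (\<lambda>(k, l). if lex_vec g k \<bullet> lex_vec g l = 0 then 1 else - 1)) = 1\<^sub>m (2 ^ g)"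
    (is "_ * (?c \<cdot>\<^sub>m ?H) = _")
proof -
  have "?H * ?H = 2 ^ g \<cdot>\<^sub>m 1\<^sub>m (2 ^ g)"
  proof (rule eq_matI)
    fix k l assume "k < dim_row (2 ^ g \<cdot>\<^sub>m (1\<^sub>m (2 ^ g) :: complex mat))"
      "l < dim_col (2 ^ g \<cdot>\<^sub>m (1\<^sub>m (2 ^ g) :: complex mat))"
    then have kl: "k < 2 ^ g" "l < 2 ^ g" by auto
    let ?f = "\<lambda>v. (if lex_vec g k \<bullet> v = 0 then 1 else - 1) * (if v \<bullet> lex_vec g l = 0 then 1 else - 1) :: complex"
    have "(?H * ?H) $$ (k, l) = (\<Sum>m<2 ^ g. ?f (lex_vec g m))"
      using kl by (simp add: scalar_prod_def lessThan_atLeast0 cong: if_cong)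
    also have "\<dots> = (\<Sum>v \<in> carrier_vec g. ?f v)"
      by (rule sum.reindex_bij_betw[OF lex_vec_bij])
    also have "\<dots> = (if lex_vec g k = lex_vec g l then 2 ^ g else 0)"
      by (rule char_sum) simp_all
    also have "lex_vec g k = lex_vec g l \<longleftrightarrow> k = l"
      using kl by (metis lex_pos_lex_vec)
    finally show "(?H * ?H) $$ (k, l) = (2 ^ g \<cdot>\<^sub>m 1\<^sub>m (2 ^ g)) $$ (k, l)" using kl by simp
  qed auto
  moreover have "T_mat g * (?c \<cdot>\<^sub>m ?H) = (((1 + \<i>) / 2) ^ g * ?c) \<cdot>\<^sub>m (?H * ?H)"
  proof -
    have *: "(x \<cdot>\<^sub>m H) * (y \<cdot>\<^sub>m H) = (x * y) \<cdot>\<^sub>m (H * H)"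
      if "H \<in> carrier_mat N N" for x y :: complex and H N
      using that by (intro eq_matI) (auto simp: ac_simps)
    show ?thesis unfolding T_mat_def by (rule *[OF mat_carrier])
  qed
  moreover have "((1 + \<i>) / 2) ^ g * ?c * 2 ^ g = 1"
  proof -
    have "(1 + \<i>) / 2 * ((1 - \<i>) / 2) * 2 = 1" by (simp add: field_simps)
    then show ?thesis by (simp only: flip: power_mult_distrib) simp
  qed
  moreover have "x \<cdot>\<^sub>m (y \<cdot>\<^sub>m 1\<^sub>m N) = 1\<^sub>m N" if "x * y = 1" for x y :: complex and N
    using that by (intro eq_matI) auto
  ultimately show ?thesis by (simp only:)
qed

lemma E_mat_inverse:
  "E_mat g * mat (2 ^ g) (2 ^ g)
     (\<lambda>(k, l). if k = l then if lex_vec g k $ (g - 1) = 0 then 1 else - \<i> else 0) = 1\<^sub>m (2 ^ g)"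
    (is "_ * ?D = _")
proof (rule eq_matI)
  fix k l assume "k < dim_row (1\<^sub>m (2 ^ g) :: complex mat)" "l < dim_col (1\<^sub>m (2 ^ g) :: complex mat)"
  then have kl: "k < 2 ^ g" "l < 2 ^ g" by auto
  have "(E_mat g * ?D) $$ (k, l) = (\<Sum>m<2 ^ g. E_mat g $$ (k, m) * ?D $$ (m, l))"
    using kl by (auto simp: E_mat_def scalar_prod_def lessThan_atLeast0 intro!: sum.cong)
  also have "\<dots> = (\<Sum>m<2 ^ g. if m = k then if k = l then 1 else 0 else 0)"
    by (rule sum.cong) (use kl in \<open>auto simp: E_mat_def\<close>)
  also have "\<dots> = 1\<^sub>m (2 ^ g) $$ (k, l)"
    using kl by (subst sum.delta) auto
  finally show "(E_mat g * ?D) $$ (k, l) = 1\<^sub>m (2 ^ g) $$ (k, l)" .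
qed (auto simp: E_mat_def)

lemma M_mat_inverse:
  assumes w: "w \<in> carrier_vec g" and M: "M \<in> carrier (GL TYPE(bit) g)"
  shows "M_mat g w M * transpose_mat (M_mat g w M) = 1\<^sub>m (2 ^ g)"
proof (rule eq_matI)
  obtain M' where Mc: "M \<in> carrier_mat g g" "M' \<in> carrier_mat g g" "M' * M = 1\<^sub>m g"
    using M by (auto simp: GL_def units_of_def Units_def ring_mat_simps)
  fix k l assume "k < dim_row (1\<^sub>m (2 ^ g) :: complex mat)" "l < dim_col (1\<^sub>m (2 ^ g) :: complex mat)"
  then have kl: "k < 2 ^ g" "l < 2 ^ g" by auto
  let ?s = "\<lambda>k. affine_map w M (lex_vec g k)"
  have sc: "?s k \<in> carrier_vec g" for k
    using w Mc by (simp add: affine_map_def)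
  have inj: "?s k = ?s l \<longleftrightarrow> k = l"
  proof
    assume "?s k = ?s l"
    moreover have "?s k + w = M *\<^sub>v lex_vec g k" for k
      using w Mc by (intro eq_vecI) (auto simp: affine_map_def add.assoc)
    ultimately have "M *\<^sub>v lex_vec g k = M *\<^sub>v lex_vec g l" by metis
    then have "(M' * M) *\<^sub>v lex_vec g k = (M' * M) *\<^sub>v lex_vec g l"
      by (simp add: assoc_mult_mat_vec[OF Mc(2,1) lex_vec_carrier])
    then have "lex_vec g k = lex_vec g l" unfolding Mc(3) by simp
    then show "k = l" using kl by (metis lex_pos_lex_vec)
  qed simp
  have e: "lex_vec g m = ?s k \<longleftrightarrow> m = lex_pos g (?s k)" if "m < 2 ^ g" for m k
    using that sc lex_pos_lex_vec lex_vec_lex_pos(1) by metis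
  have "(M_mat g w M * transpose_mat (M_mat g w M)) $$ (k, l) =
    (\<Sum>m<2 ^ g. (if lex_vec g m = ?s k then 1 else 0) * (if lex_vec g m = ?s l then 1 else 0))"
    using kl by (simp add: M_mat_def scalar_prod_def lessThan_atLeast0 cong: if_cong)
  also have "\<dots> = (\<Sum>m<2 ^ g. if m = lex_pos g (?s k) then if k = l then 1 else 0 else 0)"
  proof (rule sum.cong[OF refl])
    fix m :: nat assume "m \<in> {..<2 ^ g}"
    then show "(if lex_vec g m = ?s k then 1 else 0) * (if lex_vec g m = ?s l then 1 else 0) =
      (if m = lex_pos g (?s k) then if k = l then 1 else 0 else (0::complex))"
      using e[of m k] inj by auto
  qed
  also have "\<dots> = (if k = l then 1 else 0)"
    using lex_vec_lex_pos(2)[OF sc[of k]] by (subst sum.delta) auto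
  finally show "(M_mat g w M * transpose_mat (M_mat g w M)) $$ (k, l) = 1\<^sub>m (2 ^ g) $$ (k, l)"
    using kl by simp
qed (auto simp: M_mat_def)

lemma G_gens_GL: "G_gens g \<subseteq> carrier (GL TYPE(complex) (2 ^ (g + 1)))"
proof -
  have "two_copies (T_mat g) \<in> carrier (GL TYPE(complex) (2 ^ (g + 1)))"
    by (rule two_copies_GL[OF _ _ T_mat_inverse]) (simp_all add: T_mat_def)
  moreover have "two_copies (E_mat g) \<in> carrier (GL TYPE(complex) (2 ^ (g + 1)))"
    by (rule two_copies_GL[OF _ _ E_mat_inverse]) (simp_all add: E_mat_def)
  moreover have "two_copies (M_mat g w M) \<in> carrier (GL TYPE(complex) (2 ^ (g + 1)))"
    if "w \<in> carrier_vec g" "M \<in> carrier (GL TYPE(bit) g)" for w M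
    by (rule two_copies_GL[OF _ _ M_mat_inverse[OF that]]) (simp_all add: M_mat_def)
  moreover have "eta8 \<cdot>\<^sub>m 1\<^sub>m (2 ^ (g + 1)) \<in> carrier (GL TYPE(complex) (2 ^ (g + 1)))"
  proof (rule GL_I)
    have "eta8 \<noteq> 0" by (simp add: eta8_def complex_eq_iff)
    then show "eta8 \<cdot>\<^sub>m 1\<^sub>m (2 ^ (g + 1)) * (inverse eta8 \<cdot>\<^sub>m 1\<^sub>m (2 ^ (g + 1))) = 1\<^sub>m (2 ^ (g + 1))"
      by (subst mult_smult_distrib[of _ "2 ^ (g + 1)" "2 ^ (g + 1)" _ "2 ^ (g + 1)"]) (auto intro!: eq_matI)
  qed auto
  ultimately show ?thesis by (auto simp: G_gens_def)
qed

theorem G_group_subgroup: "subgroup (G_group g) (GL TYPE(complex) (2 ^ (g + 1)))"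
  unfolding G_group_def
  by (rule group.generate_is_subgroup[OF group_GL G_gens_GL])

end

theory Submission
  imports Defs
begin

text \<open>
  The Jacobi polynomial is a sum over tuples of codewords of a product over the coordinates of
  the code, so replacing the variables by linear forms is done one coordinate at a time.
  Under \<open>T\<^sub>g\<close> the product of the linear forms is expanded and the character sums over the code
  select the tuples of dual codewords, as in the MacWilliams identity; the scalar that
  remains is a power of \<open>(\<eta>\<^sub>8)\<^sup>n\<close>. Applying the same identity in genus one to the
  function \<open>w \<mapsto> \<i> ^ wt w\<close>, which is 1 on the code, gives \<open>(1 + \<i>)\<^sup>n = |C|\<close>, whose absolute
  value shows \<open>(\<eta>\<^sub>8)\<^sup>n = 1\<close>. Under \<open>E\<^sub>g\<close> a term gets multiplied by \<open>\<i> ^ wt (u\<^sub>g) = 1\<close>, and an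
  affine map permutes the tuples of codewords because the code is linear and contains the
  all-one vector.
\<close>

section \<open>Sums over tuples of codewords and the sign character\<close>

text \<open>Every coordinate \<open>i\<close> has its own weight function \<open>z i\<close> on
  columns, so coordinates inside and outside \<open>T\<close> can be treated alike. The ring is left
  open because both complex weights and polynomial weights occur.\<close>

definition tuple_sum ::
    "nat \<Rightarrow> nat \<Rightarrow> bit vec set \<Rightarrow> (nat \<Rightarrow> bit vec \<Rightarrow> 'a::comm_ring_1) \<Rightarrow> 'a" where
  "tuple_sum g n C z = (\<Sum>u \<in> {..<g} \<rightarrow>\<^sub>E C. \<Prod>i<n. z i (vec g (\<lambda>j. u j $ i)))"

text \<open>The nontrivial additive character of the field with two elements.\<close>

definition bsign :: "bit \<Rightarrow> 'a::comm_ring_1" where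
  "bsign b = (if b = 0 then 1 else - 1)"

lemma bsign_0 [simp]: "bsign 0 = 1"
  and bsign_1 [simp]: "bsign 1 = - 1"
  by (simp_all add: bsign_def)

lemma bsign_add: "bsign (a + b) = bsign a * bsign b"
  by (cases a; cases b) (simp_all add: bsign_def)

lemma bsign_sum: "bsign (sum f A) = (\<Prod>i\<in>A. bsign (f i))"
  by (induction A rule: infinite_finite_induct) (simp_all add: bsign_add del: add_bit_eq_xor)

lemma bsign_scalar_prod: "bsign (u \<bullet> v) = (\<Prod>i<dim_vec v. bsign (u $ i * v $ i))"
  unfolding scalar_prod_def bsign_sum lessThan_atLeast0 ..

lemma of_int_bsign: "of_int (bsign b) = bsign b"
  by (simp add: bsign_def)

lemma tuple_sum_cong:
  assumes "\<And>i a. i < n \<Longrightarrow> a \<in> carrier_vec g \<Longrightarrow> z i a = z' i a"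
  shows "tuple_sum g n C z = tuple_sum g n C z'"
  unfolding tuple_sum_def using assms by (intro sum.cong prod.cong) auto

lemma tuple_sum_scale:
  "tuple_sum g n C (\<lambda>i a. c * z i a) = c ^ n * tuple_sum g n C z"
  by (simp add: tuple_sum_def prod.distrib sum_distrib_left)

section \<open>Self-dual codes: character sums and the MacWilliams identity\<close>

locale self_dual_code =
  fixes n :: nat and C :: "bit vec set"
  assumes self_dual: "C = dual_code n C"
begin

lemma mem_code_iff: "v \<in> C \<longleftrightarrow> v \<in> carrier_vec n \<and> (\<forall>u\<in>C. u \<bullet> v = 0)"
  using self_dual unfolding dual_code_def by blast

lemma code_carrier: "v \<in> C \<Longrightarrow> v \<in> carrier_vec n"
  using mem_code_iff by blast

lemma dim_code [simp]: "v \<in> C \<Longrightarrow> dim_vec v = n"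
  using code_carrier by auto

lemma finite_code [simp]: "finite C"
  by (rule finite_subset[OF _ card_carrier_vec_bit(1)[of n]]) (auto intro: code_carrier)

lemma zero_code: "0\<^sub>v n \<in> C"
  unfolding mem_code_iff[of "0\<^sub>v n"] using code_carrier by auto

text \<open>Orthogonality to a fixed word is a linear condition, and \<open>C\<close> is cut out by
  such conditions because it equals its dual.\<close>

lemma add_code:
  assumes "u \<in> C" "v \<in> C"
  shows "u + v \<in> C"
proof -
  have "w \<bullet> (u + v) = 0" if "w \<in> C" for w
    using scalar_prod_add_distrib[of w n u v] assms that mem_code_iff[of u] mem_code_iff[of v]
      code_carrier by auto
  then show ?thesis
    unfolding mem_code_iff[of "u + v"] using assms code_carrier by auto
qed

lemma card_code_pos: "card C > 0"
  using zero_code by (auto simp: card_gt_0_iff)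

text \<open>For \<open>w\<close> in \<open>C\<close> all terms are 1, by self-duality. Otherwise
  some codeword \<open>c\<close> has product 1 with \<open>w\<close>, and translation by
  \<open>c\<close> permutes \<open>C\<close> while flipping the sign of every term.\<close>

lemma bsign_sum_code:
  assumes w: "w \<in> carrier_vec n"
  shows "(\<Sum>u\<in>C. bsign (u \<bullet> w)) = (if w \<in> C then of_nat (card C) else (0::'a::comm_ring_1))"
proof (cases "w \<in> C")
  case True
  then have "bsign (u \<bullet> w) = (1::'a)" if "u \<in> C" for u
    using that mem_code_iff[of w] by simp
  with True show ?thesis by simp
next
  case False
  then obtain c where c: "c \<in> C" "c \<bullet> w = 1"
    using w mem_code_iff[of w] bit.exhaust by auto
  have cc: "u + c + c = u" if "u \<in> C" for u
    using that c(1) by (intro eq_vecI) (auto simp: add.assoc)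
  \<comment> \<open>The sum is taken in the integers, where being equal to its own negative forces
    it to vanish; in a general commutative ring 2 may be a zero divisor. The result is then mapped
    over by \<open>of_int\<close>.\<close>
  have "(\<Sum>u\<in>C. bsign (u \<bullet> w)) = (\<Sum>u\<in>C. bsign ((u + c) \<bullet> w) :: int)"
    by (rule sum.reindex_bij_witness[where i = "\<lambda>u. u + c" and j = "\<lambda>u. u + c"])
      (auto simp: cc c add_code)
  also have "\<dots> = (\<Sum>u\<in>C. - bsign (u \<bullet> w))"
  proof (rule sum.cong[OF refl])
    fix u assume "u \<in> C"
    then have "(u + c) \<bullet> w = u \<bullet> w + 1"
      using c w by (subst add_scalar_prod_distrib[of _ n]) (auto intro: code_carrier)
    then show "bsign ((u + c) \<bullet> w) = - (bsign (u \<bullet> w) :: int)" by (simp only: bsign_add) simp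
  qed
  finally have "(\<Sum>u\<in>C. bsign (u \<bullet> w)) = (0::int)" by (simp add: sum_negf)
  then have "of_int (\<Sum>u\<in>C. bsign (u \<bullet> w)) = (0::'a)" by simp
  with False show ?thesis by (simp add: of_int_bsign)
qed

text \<open>Pairing two matrices column by column or row by row gives the same sign. Taken by rows,
  the sum factors into \<open>g\<close> independent character sums over \<open>C\<close>.\<close>

lemma bsign_sum_tuples:
  assumes w: "w \<in> {..<g} \<rightarrow>\<^sub>E carrier_vec n"
  shows "(\<Sum>u \<in> {..<g} \<rightarrow>\<^sub>E C. \<Prod>i<n. bsign (vec g (\<lambda>j. u j $ i) \<bullet> vec g (\<lambda>j. w j $ i))) =
    (if w \<in> {..<g} \<rightarrow>\<^sub>E C then of_nat (card C) ^ g else (0::'a::comm_ring_1))"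
proof -
  have wc: "w j \<in> carrier_vec n" if "j < g" for j using w that by auto
  have "(\<Sum>u \<in> {..<g} \<rightarrow>\<^sub>E C. \<Prod>i<n. bsign (vec g (\<lambda>j. u j $ i) \<bullet> vec g (\<lambda>j. w j $ i))) =
      (\<Sum>u \<in> {..<g} \<rightarrow>\<^sub>E C. \<Prod>j<g. bsign (u j \<bullet> w j) :: 'a)"
  proof (rule sum.cong[OF refl])
    fix u :: "nat \<Rightarrow> bit vec"
    have "(\<Prod>i<n. bsign (vec g (\<lambda>j. u j $ i) \<bullet> vec g (\<lambda>j. w j $ i))) =
        (\<Prod>i<n. \<Prod>j<g. bsign (u j $ i * w j $ i) :: 'a)"
      by (simp add: bsign_scalar_prod del: mult_bit_eq_and)
    also have "\<dots> = (\<Prod>j<g. \<Prod>i<n. bsign (u j $ i * w j $ i))"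
      by (rule prod.swap)
    also have "\<dots> = (\<Prod>j<g. bsign (u j \<bullet> w j))"
      by (intro prod.cong refl) (simp only: bsign_scalar_prod carrier_vecD[OF wc] lessThan_iff)
    finally show "(\<Prod>i<n. bsign (vec g (\<lambda>j. u j $ i) \<bullet> vec g (\<lambda>j. w j $ i))) =
        (\<Prod>j<g. bsign (u j \<bullet> w j) :: 'a)" .
  qed
  also have "\<dots> = (\<Prod>j<g. \<Sum>c\<in>C. bsign (c \<bullet> w j))"
    by (rule prod_sum_PiE[symmetric]) auto
  also have "\<dots> = (\<Prod>j<g. if w j \<in> C then of_nat (card C) else 0)"
    using wc by (intro prod.cong refl bsign_sum_code) auto
  also have "\<dots> = (if w \<in> {..<g} \<rightarrow>\<^sub>E C then of_nat (card C) ^ g else 0)"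
  proof (cases "w \<in> {..<g} \<rightarrow>\<^sub>E C")
    case True
    then show ?thesis by (auto simp: PiE_iff)
  next
    case False
    then obtain j where "j < g" "w j \<notin> C" using w by (auto simp: PiE_iff)
    then have "(\<Prod>j<g. if w j \<in> C then of_nat (card C) else 0) = (0::'a)"
      by (intro prod_zero) auto
    with False show ?thesis by simp
  qed
  finally show ?thesis .
qed

text \<open>Expanding the product picks one column \<open>b i\<close> per coordinate. Read as rows,
  these columns form a tuple \<open>w\<close> of words, and after exchanging the sums the character
  sum over \<open>u\<close> keeps exactly the tuples \<open>w\<close> of codewords.\<close>

lemma macwilliams:
  fixes z :: "nat \<Rightarrow> bit vec \<Rightarrow> 'a::comm_ring_1"
  shows "tuple_sum g n C (\<lambda>i a. \<Sum>b\<in>carrier_vec g. bsign (a \<bullet> b) * z i b) =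
    of_nat (card C) ^ g * tuple_sum g n C z"
proof -
  let ?W = "{..<g} \<rightarrow>\<^sub>E (carrier_vec n :: bit vec set)"
  let ?col = "\<lambda>u i. vec g (\<lambda>j. u j $ i) :: bit vec"
  have CW: "({..<g} \<rightarrow>\<^sub>E C) \<subseteq> ?W" by (rule PiE_mono) (auto intro: code_carrier)
  have fin: "finite ?W" by (intro finite_PiE) (auto simp: card_carrier_vec_bit)
  have "tuple_sum g n C (\<lambda>i a. \<Sum>b\<in>carrier_vec g. bsign (a \<bullet> b) * z i b) =
      (\<Sum>u \<in> {..<g} \<rightarrow>\<^sub>E C. \<Sum>b \<in> {..<n} \<rightarrow>\<^sub>E carrier_vec g.
        \<Prod>i<n. bsign (?col u i \<bullet> b i) * z i (b i))"
    unfolding tuple_sum_def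
    by (intro sum.cong refl prod_sum_PiE) (auto simp: card_carrier_vec_bit)
  \<comment> \<open>Transposition of a matrix: \<open>n\<close> columns of length \<open>g\<close>
    become \<open>g\<close> rows of length \<open>n\<close>.\<close>
  also have "\<dots> = (\<Sum>u \<in> {..<g} \<rightarrow>\<^sub>E C. \<Sum>w \<in> ?W. \<Prod>i<n. bsign (?col u i \<bullet> ?col w i) * z i (?col w i))"
  proof (rule sum.cong[OF refl])
    fix u :: "nat \<Rightarrow> bit vec"
    show "(\<Sum>b \<in> {..<n} \<rightarrow>\<^sub>E carrier_vec g. \<Prod>i<n. bsign (?col u i \<bullet> b i) * z i (b i)) =
        (\<Sum>w \<in> ?W. \<Prod>i<n. bsign (?col u i \<bullet> ?col w i) * z i (?col w i))"
    proof (rule sum.reindex_bij_witness[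
        where i = "\<lambda>w. \<lambda>i\<in>{..<n}. ?col w i" and j = "\<lambda>b. \<lambda>j\<in>{..<g}. vec n (\<lambda>i. b i $ j)"])
      fix b assume b: "b \<in> {..<n} \<rightarrow>\<^sub>E (carrier_vec g :: bit vec set)"
      let ?w = "\<lambda>j\<in>{..<g}. vec n (\<lambda>i. b i $ j)"
      have c: "?col ?w i = b i" if "i < n" for i
      proof -
        have "dim_vec (b i) = g" using PiE_mem[OF b, of i] that by simp
        with that show ?thesis by (intro eq_vecI) auto
      qed
      then show "(\<lambda>i\<in>{..<n}. ?col ?w i) = b"
        using b by (intro PiE_ext[of _ "{..<n}" "\<lambda>_. carrier_vec g"]) auto
      show "?w \<in> ?W" by auto
      show "(\<Prod>i<n. bsign (?col u i \<bullet> ?col ?w i) * z i (?col ?w i)) =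
          (\<Prod>i<n. bsign (?col u i \<bullet> b i) * z i (b i))"
        by (rule prod.cong) (simp_all only: c lessThan_iff)
    next
      fix w assume w: "w \<in> ?W"
      show "(\<lambda>i\<in>{..<n}. ?col w i) \<in> {..<n} \<rightarrow>\<^sub>E carrier_vec g" by auto
      have "vec n (\<lambda>i. (\<lambda>i\<in>{..<n}. ?col w i) i $ j) = w j" if "j < g" for j
      proof -
        have "dim_vec (w j) = n" using PiE_mem[OF w, of j] that by simp
        with that show ?thesis by (intro eq_vecI) auto
      qed
      then show "(\<lambda>j\<in>{..<g}. vec n (\<lambda>i. (\<lambda>i\<in>{..<n}. ?col w i) i $ j)) = w"
        using w by (intro PiE_ext[of _ "{..<g}" "\<lambda>_. carrier_vec n"]) auto
    qed
  qed
  also have "\<dots> = (\<Sum>w \<in> ?W. \<Sum>u \<in> {..<g} \<rightarrow>\<^sub>E C.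
      \<Prod>i<n. bsign (?col u i \<bullet> ?col w i) * z i (?col w i))"
    by (rule sum.swap)
  also have "\<dots> = (\<Sum>w \<in> ?W. (\<Sum>u \<in> {..<g} \<rightarrow>\<^sub>E C. \<Prod>i<n. bsign (?col u i \<bullet> ?col w i)) *
      (\<Prod>i<n. z i (?col w i)))"
    by (simp add: prod.distrib sum_distrib_right)
  also have "\<dots> = (\<Sum>w \<in> ?W. (if w \<in> {..<g} \<rightarrow>\<^sub>E C then of_nat (card C) ^ g else 0) *
      (\<Prod>i<n. z i (?col w i)))"
    by (rule sum.cong[OF refl]) (simp only: bsign_sum_tuples)
  also have "\<dots> = (\<Sum>w \<in> {..<g} \<rightarrow>\<^sub>E C. of_nat (card C) ^ g * (\<Prod>i<n. z i (?col w i)))"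
    using CW fin by (intro sum.mono_neutral_cong_right) auto
  finally show ?thesis by (simp add: tuple_sum_def sum_distrib_left)
qed

lemma tuple_sum_genus_1:
  "tuple_sum 1 n C (\<lambda>i a. z i (a $ 0)) = (\<Sum>c\<in>C. \<Prod>i<n. z i (c $ i))"
  unfolding tuple_sum_def
  by (rule sum.reindex_bij_witness[where i = "\<lambda>c. \<lambda>j\<in>{..<1}. c" and j = "\<lambda>u. u 0"])
    (auto simp: PiE_iff extensional_def fun_eq_iff)

text \<open>An affine map applied to all columns replaces each row by a linear combination of the
  rows, plus possibly the all-one word. The rows remain codewords, and the inverse affine map undoes
  this, so the tuples are permuted.\<close>

lemma tuple_sum_affine:
  assumes w: "w \<in> carrier_vec g" and M: "M \<in> carrier (GL TYPE(bit) g)"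
    and one: "vec n (\<lambda>_. 1) \<in> C"
  shows "tuple_sum g n C (\<lambda>i a. z i (affine_map w M a)) = tuple_sum g n C z"
proof -
  obtain M' where Mc: "M \<in> carrier_mat g g" "M' \<in> carrier_mat g g" "M' * M = 1\<^sub>m g" "M * M' = 1\<^sub>m g"
    using M by (auto simp: GL_def units_of_def Units_def ring_mat_simps)
  let ?col = "\<lambda>u i. vec g (\<lambda>j. u j $ i) :: bit vec"
  \<comment> \<open>Applies \<open>F\<close> to every column and reads off the rows of the
    result.\<close>
  let ?rows = "\<lambda>F u. \<lambda>j\<in>{..<g}. vec n (\<lambda>i. F (?col u i) $ j)"
  have cols: "?col (?rows F u) i = F (?col u i)"
    if "i < n" "F (?col u i) \<in> carrier_vec g" for F :: "bit vec \<Rightarrow> bit vec" and u i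
    using that by (intro eq_vecI) auto
  have sum_code: "finite A \<Longrightarrow> (\<And>k. k \<in> A \<Longrightarrow> f k \<in> C) \<Longrightarrow> vec n (\<lambda>i. \<Sum>k\<in>A. f k $ i) \<in> C"
    for f :: "nat \<Rightarrow> bit vec" and A
  proof (induction rule: finite_induct)
    case empty
    have "vec n (\<lambda>i. 0) = (0\<^sub>v n :: bit vec)" by auto
    then show ?case using zero_code by simp
  next
    case (insert k A)
    have "vec n (\<lambda>i. \<Sum>k\<in>insert k A. f k $ i) = f k + vec n (\<lambda>i. \<Sum>k\<in>A. f k $ i)"
      using insert by (intro eq_vecI) (auto simp del: add_bit_eq_xor)
    then show ?case using insert by (auto intro!: add_code)
  qed
  have rows_code: "?rows (affine_map v N) u \<in> {..<g} \<rightarrow>\<^sub>E C"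
    if u: "u \<in> {..<g} \<rightarrow>\<^sub>E C" and v: "v \<in> carrier_vec g" and N: "N \<in> carrier_mat g g" for u v N
  proof (intro PiE_I)
    fix j assume j: "j \<in> {..<g}"
    \<comment> \<open>Over two elements, row \<open>j\<close> of the linear part is the sum of those
      \<open>u k\<close> with coefficient 1.\<close>
    let ?f = "\<lambda>k. if N $$ (j, k) = 1 then u k else 0\<^sub>v n"
    have f: "vec n (\<lambda>i. \<Sum>k<g. ?f k $ i) \<in> C"
      by (rule sum_code) (use u zero_code in auto)
    have e: "affine_map v N (?col u i) $ j = (\<Sum>k<g. ?f k $ i) + v $ j" if "i < n" for i
    proof -
      have "affine_map v N (?col u i) $ j = (\<Sum>k<g. N $$ (j, k) * u k $ i) + v $ j"
        using j v N by (simp add: affine_map_def scalar_prod_def lessThan_atLeast0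
            del: add_bit_eq_xor mult_bit_eq_and)
      also have "(\<Sum>k<g. N $$ (j, k) * u k $ i) = (\<Sum>k<g. ?f k $ i)"
        by (rule sum.cong) (use that in auto)
      finally show ?thesis .
    qed
    have "vec n (\<lambda>i. affine_map v N (?col u i) $ j) =
        (if v $ j = 0 then vec n (\<lambda>i. \<Sum>k<g. ?f k $ i)
         else vec n (\<lambda>i. \<Sum>k<g. ?f k $ i) + vec n (\<lambda>_. 1))"
      by (intro eq_vecI) (auto simp: e simp del: add_bit_eq_xor)
    then show "?rows (affine_map v N) u j \<in> C"
      using j f one by (auto simp: add_code)
  qed auto
  \<comment> \<open>The inverse map sends \<open>a\<close> to \<open>M'\<close> applied to
    \<open>a - w\<close>; the minus sign disappears in characteristic 2.\<close>
  let ?w' = "M' *\<^sub>v w"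
  have w': "?w' \<in> carrier_vec g" using Mc w by simp
  have cancel: "x + y + y = x" if "x \<in> carrier_vec g" "y \<in> carrier_vec g" for x y :: "bit vec"
    by (rule eq_vecI) (use that in \<open>auto simp: add.assoc\<close>)
  have inv1: "affine_map ?w' M' (affine_map w M a) = a" if a: "a \<in> carrier_vec g" for a
  proof -
    have "affine_map ?w' M' (affine_map w M a) = (M' * M) *\<^sub>v a + M' *\<^sub>v w + M' *\<^sub>v w"
      unfolding affine_map_def using a w Mc(1,2)
      by (simp add: mult_add_distrib_mat_vec[of _ g g] assoc_mult_mat_vec[of _ g g _ g])
    also have "\<dots> = a" unfolding Mc(3) using cancel[OF a w'] a by simp
    finally show ?thesis .
  qed
  have inv2: "affine_map w M (affine_map ?w' M' a) = a" if a: "a \<in> carrier_vec g" for a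
  proof -
    have "affine_map w M (affine_map ?w' M' a) = (M * M') *\<^sub>v a + (M * M') *\<^sub>v w + w"
      unfolding affine_map_def using a w Mc(1,2)
      by (simp add: mult_add_distrib_mat_vec[of _ g g] assoc_mult_mat_vec[of _ g g _ g])
    also have "\<dots> = a" unfolding Mc(4) using cancel[OF a w] a w by simp
    finally show ?thesis .
  qed
  have car: "affine_map v N a \<in> carrier_vec g"
    if "v \<in> carrier_vec g" "N \<in> carrier_mat g g" for v N a
    using that by (intro carrier_vecI) (simp add: affine_map_def)
  have inv_rows: "?rows F (?rows F' u) = u"
    if u: "u \<in> {..<g} \<rightarrow>\<^sub>E C" and F': "\<And>a. F' a \<in> carrier_vec g"
      and FF': "\<And>a. a \<in> carrier_vec g \<Longrightarrow> F (F' a) = a" for F F' u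
  proof -
    have r: "F (?col (?rows F' u) i) = ?col u i" if "i < n" for i
      by (subst cols[OF that F']) (simp add: FF')
    have "vec n (\<lambda>i. F (?col (?rows F' u) i) $ j) = u j" if "j < g" for j
    proof (rule eq_vecI)
      have d: "dim_vec (u j) = n" using PiE_mem[OF u, of j] that by simp
      then show "dim_vec (vec n (\<lambda>i. F (?col (?rows F' u) i) $ j)) = dim_vec (u j)" by simp
      show "vec n (\<lambda>i. F (?col (?rows F' u) i) $ j) $ i = u j $ i" if i: "i < dim_vec (u j)" for i
        using i \<open>j < g\<close> unfolding d by (simp only: index_vec r)
    qed
    then show ?thesis
      using u by (intro PiE_ext[of _ "{..<g}" "\<lambda>_. C"]) auto
  qed
  show ?thesis
    unfolding tuple_sum_def
  proof (rule sum.reindex_bij_witness[where i = "?rows (affine_map ?w' M')" and j = "?rows (affine_map w M)"])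
    fix u assume u: "u \<in> {..<g} \<rightarrow>\<^sub>E C"
    show "?rows (affine_map w M) u \<in> {..<g} \<rightarrow>\<^sub>E C" "?rows (affine_map ?w' M') u \<in> {..<g} \<rightarrow>\<^sub>E C"
      by (rule rows_code[OF u]; use w w' Mc in simp)+
    show "?rows (affine_map ?w' M') (?rows (affine_map w M) u) = u"
      by (rule inv_rows[OF u car[OF w Mc(1)] inv1])
    show "?rows (affine_map w M) (?rows (affine_map ?w' M') u) = u"
      by (rule inv_rows[OF u car[OF w' Mc(2)] inv2])
    show "(\<Prod>i<n. z i (?col (?rows (affine_map w M) u) i)) =
        (\<Prod>i<n. z i (affine_map w M (?col u i)))"
      by (rule prod.cong[OF refl], subst cols) (auto simp: car[OF w Mc(1)])
  qed
qed

end

section \<open>Doubly even codes and the values of the scalars\<close>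

locale type_II = self_dual_code +
  assumes doubly_even: "u \<in> C \<Longrightarrow> 4 dvd weight u"
begin

lemma prod_weight:
  fixes x :: "'a::comm_monoid_mult"
  assumes "u \<in> C"
  shows "(\<Prod>i<n. if u $ i = 0 then 1 else x) = x ^ weight u"
proof -
  have "(\<Prod>i<n. if u $ i = 0 then 1 else x) = (\<Prod>i \<in> {i. i < n \<and> u $ i \<noteq> 0}. x)"
    by (rule prod.mono_neutral_cong_right) (auto split: if_splits)
  with assms show ?thesis by (simp add: weight_def)
qed

text \<open>The product is a power of \<open>x\<close> with exponent divisible by 4. It is applied
  to \<open>-1\<close> in the integers, to complex fourth roots of unity and to the constant
  polynomial \<open>Const \<i>\<close>.\<close>

lemma prod_fourth_root:
  fixes x :: "'a::comm_monoid_mult"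
  assumes "u \<in> C" "x ^ 4 = 1"
  shows "(\<Prod>i<n. if u $ i = 0 then 1 else x) = 1"
  using doubly_even[OF assms(1)] assms by (auto simp: prod_weight power_mult elim!: dvdE)

text \<open>The sign of the product of \<open>u\<close> with the all-one word is \<open>-1\<close>
  to the power \<open>weight u\<close>, hence 1, so the all-one word lies in the dual of
  \<open>C\<close>.\<close>

lemma one_code: "vec n (\<lambda>_. 1) \<in> C"
proof -
  have "u \<bullet> vec n (\<lambda>_. 1) = 0" if u: "u \<in> C" for u
  proof -
    have "bsign (u \<bullet> vec n (\<lambda>_. 1)) = (\<Prod>i<n. if u $ i = 0 then 1 else (- 1 :: int))"
      unfolding bsign_scalar_prod by (intro prod.cong) (auto simp: bsign_def)
    also have "\<dots> = 1" by (rule prod_fourth_root[OF u]) simp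
    finally show ?thesis by (simp add: bsign_def split: if_splits)
  qed
  then show ?thesis unfolding mem_code_iff[of "vec n (\<lambda>_. 1)"] by simp
qed

text \<open>MacWilliams in genus one for the weights 1 and \<open>\<i>\<close>: up to the factor
  \<open>1 + \<i>\<close> they are transformed into 1 and \<open>-\<i>\<close>. Both weightings give
  every codeword the value 1, so the identity reads
  \<open>|C| * |C| = (1 + \<i>) ^ n * |C|\<close>.\<close>

lemma card_code: "of_nat (card C) = (1 + \<i>) ^ n"
proof -
  let ?z = "\<lambda>x i b. if b = 0 then 1 else x :: complex"
  have V: "carrier_vec 1 = {vec 1 (\<lambda>_. 0), vec 1 (\<lambda>_. 1) :: bit vec}"
  proof
    show "carrier_vec 1 \<subseteq> {vec 1 (\<lambda>_. 0), vec 1 (\<lambda>_. 1) :: bit vec}"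
    proof
      fix b :: "bit vec" assume "b \<in> carrier_vec 1"
      then show "b \<in> {vec 1 (\<lambda>_. 0), vec 1 (\<lambda>_. 1)}"
        by (cases "b $ 0") (auto intro!: eq_vecI)
    qed
  qed auto
  have "vec 1 (\<lambda>_. 0) \<noteq> (vec 1 (\<lambda>_. 1) :: bit vec)"
    by (metis index_vec less_one zero_neq_one)
  then have s: "(\<Sum>b\<in>carrier_vec 1. f b) = f (vec 1 (\<lambda>_. 0)) + f (vec 1 (\<lambda>_. 1))" for f :: "bit vec \<Rightarrow> complex"
    unfolding V by simp
  have one: "tuple_sum 1 n C (\<lambda>i a. ?z x i (a $ 0)) = of_nat (card C)" if "x ^ 4 = 1" for x
  proof -
    have "(\<Prod>i<n. ?z x i (c $ i)) = 1" if "c \<in> C" for c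
      using prod_fourth_root[OF that \<open>x ^ 4 = 1\<close>] by simp
    then show ?thesis unfolding tuple_sum_genus_1[of "?z x"] by simp
  qed
  have "of_nat (card C) ^ 1 * of_nat (card C) =
      of_nat (card C) ^ 1 * tuple_sum 1 n C (\<lambda>i a. ?z \<i> i (a $ 0))"
    by (subst one) simp_all
  also have "\<dots> = tuple_sum 1 n C (\<lambda>i a. \<Sum>b\<in>carrier_vec 1. bsign (a \<bullet> b) * ?z \<i> i (b $ 0))"
    by (rule macwilliams[symmetric])
  \<comment> \<open>Here \<open>1 - \<i> = (1 + \<i>) * (- \<i>)\<close> is used.\<close>
  also have "\<dots> = tuple_sum 1 n C (\<lambda>i a. (1 + \<i>) * ?z (- \<i>) i (a $ 0))"
  proof (rule tuple_sum_cong)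
    fix a :: "bit vec"
    show "(\<Sum>b\<in>carrier_vec 1. bsign (a \<bullet> b) * ?z \<i> i (b $ 0)) = (1 + \<i>) * ?z (- \<i>) i (a $ 0)" for i
      unfolding s by (cases "a $ 0") (simp_all add: scalar_prod_def algebra_simps)
  qed
  also have "\<dots> = (1 + \<i>) ^ n * of_nat (card C)"
    unfolding tuple_sum_scale by (subst one) simp_all
  finally have "complex_of_nat (card C) * of_nat (card C) = (1 + \<i>) ^ n * of_nat (card C)"
    by (simp only: power_one_right)
  moreover have "complex_of_nat (card C) \<noteq> 0" using card_code_pos by (simp only: of_nat_eq_0_iff)
  ultimately show ?thesis by (simp only: mult_cancel_right) blast
qed

text \<open>Absolute values are taken in \<open>card_code\<close>.\<close>

lemma sqrt_2_power: "complex_of_real (sqrt 2) ^ n = of_nat (card C)"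
proof -
  have "cmod (1 + \<i>) = sqrt 2" by (simp add: cmod_def)
  then have "sqrt 2 ^ n = real (card C)"
    using arg_cong[OF card_code, of cmod] by (simp add: norm_power)
  then show ?thesis by (metis of_real_of_nat_eq of_real_power)
qed

lemma eta8_power: "eta8 ^ n = 1"
  using card_code_pos by (auto simp: eta8_def power_divide sqrt_2_power simp flip: card_code)

text \<open>Since \<open>(1 + \<i>) / 2\<close> times the square root of 2 is \<open>eta8\<close>,
  each of the \<open>g\<close> factors contributes \<open>eta8 ^ n = 1\<close>.\<close>

lemma T_scalar: "(((1 + \<i>) / 2) ^ g) ^ n * of_nat (card C) ^ g = 1"
proof -
  have "(1 + \<i>) / 2 * complex_of_real (sqrt 2) = eta8"
    by (simp add: eta8_def field_simps flip: of_real_mult)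
  then have "((1 + \<i>) / 2) ^ n * of_nat (card C) = 1"
    by (simp only: eta8_power flip: sqrt_2_power power_mult_distrib)
  moreover have "(((1 + \<i>) / 2) ^ g) ^ n * of_nat (card C) ^ g = (((1 + \<i>) / 2) ^ n * of_nat (card C)) ^ g"
    unfolding power_mult_distrib power_mult[symmetric] mult.commute[of g n] ..
  ultimately show ?thesis by simp
qed

end

section \<open>Substitution into polynomials\<close>

interpretation Const: comm_ring_hom Const
proof
  show "Const (x + y) = Const x + Const y" "Const (x * y) = Const x * Const y" for x y
    by (simp_all add: Const_def single_add mult_single)
qed (simp_all add: Const_def)

definition monom_value :: "('a \<Rightarrow> 'b::comm_semiring_1) \<Rightarrow> ('a \<Rightarrow>\<^sub>0 nat) \<Rightarrow> 'b" where
  "monom_value s m = (\<Prod>z \<in> Poly_Mapping.keys m. s z ^ Poly_Mapping.lookup m z)"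

lemma monom_value_superset:
  assumes "finite A" "Poly_Mapping.keys m \<subseteq> A"
  shows "monom_value s m = (\<Prod>z \<in> A. s z ^ Poly_Mapping.lookup m z)"
  unfolding monom_value_def using assms
  by (intro prod.mono_neutral_left) (auto simp: in_keys_iff)

lemma monom_value_0 [simp]: "monom_value s 0 = 1"
  by (simp add: monom_value_def)

lemma monom_value_single [simp]: "monom_value s (Poly_Mapping.single z 1) = s z"
  by (simp add: monom_value_def)

lemma monom_value_add: "monom_value s (m + m') = monom_value s m * monom_value s m'"
proof -
  let ?A = "Poly_Mapping.keys m \<union> Poly_Mapping.keys m'"
  have "monom_value s (m + m') = (\<Prod>z \<in> ?A. s z ^ Poly_Mapping.lookup (m + m') z)"
    by (rule monom_value_superset) (auto simp: keys_add)
  also have "\<dots> = (\<Prod>z \<in> ?A. s z ^ Poly_Mapping.lookup m z) * (\<Prod>z \<in> ?A. s z ^ Poly_Mapping.lookup m' z)"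
    by (simp add: lookup_add power_add prod.distrib)
  also have "\<dots> = monom_value s m * monom_value s m'"
    by (simp add: monom_value_superset[of ?A])
  finally show ?thesis .
qed

lemma monom_value_sum: "monom_value s (sum f A) = (\<Prod>i\<in>A. monom_value s (f i))"
  by (induction A rule: infinite_finite_induct) (simp_all add: monom_value_add)

text \<open>Monomials outside the support have coefficient 0. A common index set is needed for sums
  of polynomials, where supports may shrink by cancellation.\<close>

lemma subst_poly_superset:
  assumes "finite A" "Poly_Mapping.keys f \<subseteq> A"
  shows "subst_poly s f = (\<Sum>m\<in>A. Const (Poly_Mapping.lookup f m) * monom_value s m)"
  unfolding subst_poly_def monom_value_def using assms
  by (intro sum.mono_neutral_left) (auto simp: in_keys_iff)

lemma subst_poly_add: "subst_poly s (f + f') = subst_poly s f + subst_poly s f'"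
proof -
  let ?A = "Poly_Mapping.keys f \<union> Poly_Mapping.keys f'"
  have "subst_poly s (f + f') = (\<Sum>m\<in>?A. Const (Poly_Mapping.lookup (f + f') m) * monom_value s m)"
    by (rule subst_poly_superset) (auto simp: keys_add)
  also have "\<dots> = subst_poly s f + subst_poly s f'"
    by (simp add: subst_poly_superset[of ?A] lookup_add Const.hom_add distrib_right sum.distrib)
  finally show ?thesis .
qed

lemma subst_poly_sum: "subst_poly s (sum f A) = (\<Sum>i\<in>A. subst_poly s (f i))"
proof -
  have "subst_poly s 0 = 0" by (simp add: subst_poly_def)
  then show ?thesis by (induction A rule: infinite_finite_induct) (simp_all add: subst_poly_add)
qed

lemma prod_Var: "(\<Prod>i\<in>A. Var (f i)) = Poly_Mapping.single (\<Sum>i\<in>A. Poly_Mapping.single (f i) 1) 1"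
  by (induction A rule: infinite_finite_induct) (simp_all add: Var_def mult_single)

text \<open>A product of variables is a single monomial with coefficient 1, and evaluating monomials
  turns sums of exponents into products. The terms of a Jacobi polynomial have this form.\<close>

lemma subst_poly_prod_Var: "subst_poly s (\<Prod>i\<in>A. Var (f i)) = (\<Prod>i\<in>A. s (f i))"
proof -
  have "subst_poly s (Poly_Mapping.single m 1) = monom_value s m" for m
    by (simp add: subst_poly_superset[of "{m}"])
  then show ?thesis by (simp only: prod_Var monom_value_sum monom_value_single)
qed

section \<open>The Jacobi polynomial as a product over coordinates\<close>

definition coord_var :: "nat set \<Rightarrow> nat \<Rightarrow> bit vec \<Rightarrow> jvar" where
  "coord_var T i = (if i \<in> T then Y else X)"

lemma prod_power_count:
  assumes "finite S" "finite A" "\<And>i. i \<in> S \<Longrightarrow> c i \<in> A"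
  shows "(\<Prod>a\<in>A. f a ^ card {i \<in> S. c i = a}) = (\<Prod>i\<in>S. f (c i) :: 'a::comm_monoid_mult)"
proof -
  have "(\<Prod>a\<in>A. f a ^ card {i \<in> S. c i = a}) = (\<Prod>a\<in>A. \<Prod>i\<in>{i \<in> S. c i = a}. f (c i))"
    by simp
  also have "\<dots> = (\<Prod>i\<in>S. f (c i))" using assms by (intro prod.group) auto
  finally show ?thesis .
qed

text \<open>The exponents count the coordinates with a given column, so collecting equal factors
  turns the product over columns \<open>a\<close> into one over coordinates.\<close>

lemma jacobi_poly_tuple_sum:
  assumes T: "T \<subseteq> {..<n}"
  shows "jacobi_poly g n C T = tuple_sum g n C (\<lambda>i a. Var (coord_var T i a))"
  unfolding jacobi_poly_def tuple_sum_def
proof (rule sum.cong[OF refl])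
  fix u :: "nat \<Rightarrow> bit vec"
  let ?col = "\<lambda>i. vec g (\<lambda>j. u j $ i)"
  have fin: "finite T" using T finite_subset by blast
  have "(\<Prod>a \<in> carrier_vec g. Var (Y a) ^ col_count g a T u * Var (X a) ^ col_count g a ({..<n} - T) u) =
      (\<Prod>i\<in>T. Var (Y (?col i))) * (\<Prod>i\<in>{..<n} - T. Var (X (?col i)))"
    unfolding prod.distrib col_count_def
    by (subst (1 2) prod_power_count) (auto simp: fin card_carrier_vec_bit)
  also have "\<dots> = (\<Prod>i\<in>T. Var (coord_var T i (?col i))) * (\<Prod>i\<in>{..<n} - T. Var (coord_var T i (?col i)))"
    by (simp add: coord_var_def)
  also have "\<dots> = (\<Prod>i<n. Var (coord_var T i (?col i)))"
    using prod.subset_diff[OF T, of "\<lambda>i. Var (coord_var T i (?col i))"] by (simp add: mult.commute)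
  finally show "(\<Prod>a \<in> carrier_vec g. Var (Y a) ^ col_count g a T u * Var (X a) ^ col_count g a ({..<n} - T) u) =
      (\<Prod>i<n. Var (coord_var T i (?col i)))" .
qed

text \<open>The vector \<open>v\<close> takes the place of the vector of variables; it is kept
  arbitrary so that matrices can be applied to it one after another.\<close>

definition coord_value :: "nat \<Rightarrow> nat set \<Rightarrow> 'a vec \<Rightarrow> nat \<Rightarrow> bit vec \<Rightarrow> 'a" where
  "coord_value g T v i a = v $ var_pos g (coord_var T i a)"

lemma coord_value_var_vec:
  assumes "a \<in> carrier_vec g"
  shows "coord_value g T (var_vec g) i a = Var (coord_var T i a)"
  using lex_vec_lex_pos[OF assms] by (simp add: coord_value_def coord_var_def var_vec_def)

lemma var_vec_carrier: "var_vec g \<in> carrier_vec (2 ^ (g + 1))"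
  unfolding carrier_vec_def by (simp add: var_vec_def)

lemma act_jacobi_poly:
  assumes "T \<subseteq> {..<n}"
  shows "act g \<tau> (jacobi_poly g n C T) =
    tuple_sum g n C (coord_value g T (map_mat Const \<tau> *\<^sub>v var_vec g))"
  unfolding act_def jacobi_poly_tuple_sum[OF assms] tuple_sum_def subst_poly_sum subst_poly_prod_Var
    coord_value_def ..

text \<open>The off-diagonal blocks vanish and both diagonal blocks are \<open>A\<close>, so the
  formula is the same for coordinates inside and outside \<open>T\<close>.\<close>

lemma coord_value_two_copies:
  assumes A: "A \<in> carrier_mat (2 ^ g) (2 ^ g)" and v: "v \<in> carrier_vec (2 ^ (g + 1))"
    and a: "a \<in> carrier_vec g"
  shows "coord_value g T (map_mat Const (two_copies A) *\<^sub>v v) i a =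
    (\<Sum>b\<in>carrier_vec g. Const (A $$ (lex_pos g a, lex_pos g b)) * coord_value g T v i b)"
proof -
  note p = lex_vec_lex_pos(2)[OF a]
  let ?r = "\<lambda>k. (map_mat Const (two_copies A) *\<^sub>v v) $ k"
  have split: "(\<Sum>l<k + m. f l) = (\<Sum>l<k. f l) + (\<Sum>l<m. f (k + l))"
    for f :: "nat \<Rightarrow> jpoly" and k m
    by (induction m) (simp_all add: add.assoc)
  have r: "?r k = (\<Sum>l<2 ^ g. Const (two_copies A $$ (k, l)) * v $ l) +
      (\<Sum>l<2 ^ g. Const (two_copies A $$ (k, 2 ^ g + l)) * v $ (2 ^ g + l))" if "k < 2 ^ g + 2 ^ g" for k
  proof -
    have "?r k = (\<Sum>l<2 ^ g + 2 ^ g. Const (two_copies A $$ (k, l)) * v $ l)"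
      using A v that by (auto simp: scalar_prod_def lessThan_atLeast0 two_copies_def intro!: sum.cong)
    then show ?thesis by (simp only: split)
  qed
  \<comment> \<open>\<open>Q\<close> stands for either constructor, which handles the two blocks at
    once.\<close>
  have "?r (var_pos g (Q a)) = (\<Sum>b\<in>carrier_vec g.
      Const (A $$ (lex_pos g a, lex_pos g b)) * v $ var_pos g (Q b))" if Q: "Q = X \<or> Q = Y" for Q
  proof -
    have "?r (var_pos g (Q a)) = (\<Sum>l<2 ^ g.
        Const (A $$ (lex_pos g a, lex_pos g (lex_vec g l))) * v $ var_pos g (Q (lex_vec g l)))"
    proof -
      have k: "var_pos g (Q a) < 2 ^ g + 2 ^ g" using Q p by auto
      show ?thesis unfolding r[OF k] using Q A p by (auto simp: two_copies_def lex_pos_lex_vec)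
    qed
    also have "\<dots> = (\<Sum>b\<in>carrier_vec g.
        Const (A $$ (lex_pos g a, lex_pos g b)) * v $ var_pos g (Q b))"
      by (rule sum.reindex_bij_betw[OF lex_vec_bij])
    finally show ?thesis .
  qed
  then show ?thesis by (simp add: coord_value_def coord_var_def)
qed

lemma map_mat_Const_mult_vec:
  assumes "A \<in> carrier_mat N N" "B \<in> carrier_mat N N" "v \<in> carrier_vec N"
  shows "map_mat Const (A * B) *\<^sub>v v = map_mat Const A *\<^sub>v (map_mat Const B *\<^sub>v v)"
  using assms by (simp add: Const.mat_hom_mult[of _ N N _ N] assoc_mult_mat_vec[of _ N N _ N])

lemma GL_D:
  assumes "A \<in> carrier (GL TYPE('a::field) N)"
  shows "A \<in> carrier_mat N N"
  using assms by (auto simp: GL_def units_of_def Units_def ring_mat_simps)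

lemma mult_GL: "A \<otimes>\<^bsub>GL TYPE('a::field) N\<^esub> B = A * B" and one_GL: "\<one>\<^bsub>GL TYPE('a::field) N\<^esub> = 1\<^sub>m N"
  by (simp_all add: GL_def units_of_def ring_mat_simps)

section \<open>Invariance under the generators and the group\<close>

context type_II
begin

text \<open>Invariance is demanded at every vector \<open>v\<close>, not only at the variables.
  Products and inverses are then handled by choosing another \<open>v\<close>, without composing
  substitutions.\<close>

definition preserves :: "nat \<Rightarrow> nat set \<Rightarrow> complex mat \<Rightarrow> bool" where
  "preserves g T \<tau> \<longleftrightarrow> (\<forall>v \<in> carrier_vec (2 ^ (g + 1)).
     tuple_sum g n C (coord_value g T (map_mat Const \<tau> *\<^sub>v v)) = tuple_sum g n C (coord_value g T v))"

text \<open>The scalar of \<open>T_mat g\<close> comes out once per coordinate and MacWilliams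
  contributes \<open>card C ^ g\<close>; by \<open>T_scalar\<close> the two cancel.\<close>

lemma preserves_T: "preserves g T (two_copies (T_mat g))"
  unfolding preserves_def
proof
  fix v :: "jpoly vec" assume v: "v \<in> carrier_vec (2 ^ (g + 1))"
  let ?c = "((1 + \<i>) / 2) ^ g"
  have "tuple_sum g n C (coord_value g T (map_mat Const (two_copies (T_mat g)) *\<^sub>v v)) =
      tuple_sum g n C (\<lambda>i a. Const ?c * (\<Sum>b\<in>carrier_vec g. bsign (a \<bullet> b) * coord_value g T v i b))"
  proof (rule tuple_sum_cong)
    fix i and a :: "bit vec" assume a: "a \<in> carrier_vec g"
    have "coord_value g T (map_mat Const (two_copies (T_mat g)) *\<^sub>v v) i a =
        (\<Sum>b\<in>carrier_vec g. Const (T_mat g $$ (lex_pos g a, lex_pos g b)) * coord_value g T v i b)"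
      by (rule coord_value_two_copies[OF _ v a]) (simp add: T_mat_def)
    also have "\<dots> = (\<Sum>b\<in>carrier_vec g. Const ?c * (bsign (a \<bullet> b) * coord_value g T v i b))"
    proof (rule sum.cong[OF refl])
      fix b :: "bit vec" assume b: "b \<in> carrier_vec g"
      have "T_mat g $$ (lex_pos g a, lex_pos g b) = ?c * bsign (a \<bullet> b)"
        using a b by (simp add: T_mat_def lex_vec_lex_pos bsign_def)
      moreover have "Const (bsign x) = bsign x" for x by (simp add: bsign_def Const.hom_uminus)
      ultimately show "Const (T_mat g $$ (lex_pos g a, lex_pos g b)) * coord_value g T v i b =
          Const ?c * (bsign (a \<bullet> b) * coord_value g T v i b)"
        by (simp only: Const.hom_mult mult.assoc)
    qed
    finally show "coord_value g T (map_mat Const (two_copies (T_mat g)) *\<^sub>v v) i a =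
        Const ?c * (\<Sum>b\<in>carrier_vec g. bsign (a \<bullet> b) * coord_value g T v i b)"
      by (simp only: sum_distrib_left)
  qed
  also have "\<dots> = Const (?c ^ n * of_nat (card C) ^ g) * tuple_sum g n C (coord_value g T v)"
    by (simp only: tuple_sum_scale macwilliams Const.hom_mult Const.hom_power Const.hom_of_nat mult.assoc)
  finally show "tuple_sum g n C (coord_value g T (map_mat Const (two_copies (T_mat g)) *\<^sub>v v)) =
      tuple_sum g n C (coord_value g T v)"
    by (simp only: T_scalar Const.hom_one mult_1)
qed

text \<open>The diagonal entry depends only on the last entry of the column, so a tuple is
  multiplied by \<open>\<i>\<close> to the weight of its last word \<open>u (g - 1)\<close>. This
  word exists as \<open>g\<close> is positive.\<close>

lemma preserves_E:
  assumes g: "g \<ge> 1"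
  shows "preserves g T (two_copies (E_mat g))"
  unfolding preserves_def
proof
  fix v :: "jpoly vec" assume v: "v \<in> carrier_vec (2 ^ (g + 1))"
  let ?e = "\<lambda>b. if b = 0 then 1 else Const \<i>"
  have "tuple_sum g n C (coord_value g T (map_mat Const (two_copies (E_mat g)) *\<^sub>v v)) =
      tuple_sum g n C (\<lambda>i a. ?e (a $ (g - 1)) * coord_value g T v i a)"
  proof (rule tuple_sum_cong)
    fix i and a :: "bit vec" assume a: "a \<in> carrier_vec g"
    have "coord_value g T (map_mat Const (two_copies (E_mat g)) *\<^sub>v v) i a =
        (\<Sum>b\<in>carrier_vec g. Const (E_mat g $$ (lex_pos g a, lex_pos g b)) * coord_value g T v i b)"
      by (rule coord_value_two_copies[OF _ v a]) (simp add: E_mat_def)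
    also have "\<dots> = (\<Sum>b\<in>carrier_vec g. if b = a then ?e (a $ (g - 1)) * coord_value g T v i a else 0)"
    proof (rule sum.cong[OF refl])
      fix b :: "bit vec" assume b: "b \<in> carrier_vec g"
      have "lex_pos g a = lex_pos g b \<longleftrightarrow> a = b" using a b by (metis lex_vec_lex_pos(1))
      then show "Const (E_mat g $$ (lex_pos g a, lex_pos g b)) * coord_value g T v i b =
          (if b = a then ?e (a $ (g - 1)) * coord_value g T v i a else 0)"
        using a b by (auto simp: E_mat_def lex_vec_lex_pos)
    qed
    also have "\<dots> = ?e (a $ (g - 1)) * coord_value g T v i a"
      using a by (simp add: card_carrier_vec_bit)
    finally show "coord_value g T (map_mat Const (two_copies (E_mat g)) *\<^sub>v v) i a = \<dots>" .
  qed
  also have "\<dots> = tuple_sum g n C (coord_value g T v)"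
    unfolding tuple_sum_def prod.distrib
  proof (rule sum.cong[OF refl])
    fix u assume u: "u \<in> {..<g} \<rightarrow>\<^sub>E C"
    have "(\<Prod>i<n. ?e (vec g (\<lambda>j. u j $ i) $ (g - 1))) = (\<Prod>i<n. ?e (u (g - 1) $ i))"
      using g by simp
    also have "\<dots> = 1"
    proof (rule prod_fourth_root)
      show "u (g - 1) \<in> C" using u g by (auto simp: PiE_iff)
      have "\<i> ^ 4 = 1" by simp
      then show "Const \<i> ^ 4 = 1" by (simp only: Const.hom_one flip: Const.hom_power)
    qed
    finally show "(\<Prod>i<n. ?e (vec g (\<lambda>j. u j $ i) $ (g - 1))) *
        (\<Prod>i<n. coord_value g T v i (vec g (\<lambda>j. u j $ i))) =
        (\<Prod>i<n. coord_value g T v i (vec g (\<lambda>j. u j $ i)))"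
      by (simp only: mult_1)
  qed
  finally show "tuple_sum g n C (coord_value g T (map_mat Const (two_copies (E_mat g)) *\<^sub>v v)) =
      tuple_sum g n C (coord_value g T v)" .
qed

text \<open>Row \<open>a\<close> of the matrix has its only nonzero entry at the image of
  \<open>a\<close>, so the columns are moved by the affine map.\<close>

lemma preserves_M:
  assumes w: "w \<in> carrier_vec g" and M: "M \<in> carrier (GL TYPE(bit) g)"
  shows "preserves g T (two_copies (M_mat g w M))"
  unfolding preserves_def
proof
  fix v :: "jpoly vec" assume v: "v \<in> carrier_vec (2 ^ (g + 1))"
  have Mc: "M \<in> carrier_mat g g"
    using M by (auto simp: GL_def units_of_def Units_def ring_mat_simps)
  have "tuple_sum g n C (coord_value g T (map_mat Const (two_copies (M_mat g w M)) *\<^sub>v v)) =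
      tuple_sum g n C (\<lambda>i a. coord_value g T v i (affine_map w M a))"
  proof (rule tuple_sum_cong)
    fix i and a :: "bit vec" assume a: "a \<in> carrier_vec g"
    have "coord_value g T (map_mat Const (two_copies (M_mat g w M)) *\<^sub>v v) i a =
        (\<Sum>b\<in>carrier_vec g. Const (M_mat g w M $$ (lex_pos g a, lex_pos g b)) * coord_value g T v i b)"
      by (rule coord_value_two_copies[OF _ v a]) (simp add: M_mat_def)
    also have "\<dots> = (\<Sum>b\<in>carrier_vec g. if b = affine_map w M a then coord_value g T v i b else 0)"
      by (rule sum.cong) (use a in \<open>auto simp: M_mat_def lex_vec_lex_pos\<close>)
    also have "\<dots> = coord_value g T v i (affine_map w M a)"
      using a w Mc by (simp add: card_carrier_vec_bit affine_map_def)
    finally show "coord_value g T (map_mat Const (two_copies (M_mat g w M)) *\<^sub>v v) i a = \<dots>" .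
  qed
  also have "\<dots> = tuple_sum g n C (coord_value g T v)"
    by (rule tuple_sum_affine[OF w M one_code])
  finally show "tuple_sum g n C (coord_value g T (map_mat Const (two_copies (M_mat g w M)) *\<^sub>v v)) =
      tuple_sum g n C (coord_value g T v)" .
qed

text \<open>Each term has \<open>n\<close> factors, so the scalar enters as
  \<open>eta8 ^ n = 1\<close>.\<close>

lemma preserves_eta8: "preserves g T (eta8 \<cdot>\<^sub>m 1\<^sub>m (2 ^ (g + 1)))"
  unfolding preserves_def
proof
  fix v :: "jpoly vec" assume v: "v \<in> carrier_vec (2 ^ (g + 1))"
  have e: "map_mat Const (eta8 \<cdot>\<^sub>m 1\<^sub>m (2 ^ (g + 1))) *\<^sub>v v = Const eta8 \<cdot>\<^sub>v v"
  proof -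
    have "row (map_mat Const (eta8 \<cdot>\<^sub>m 1\<^sub>m N)) i = Const eta8 \<cdot>\<^sub>v unit_vec N i" if "i < N" for N i
      using that by (intro eq_vecI) auto
    then show ?thesis using v by (intro eq_vecI) (auto simp del: power_Suc)
  qed
  have "tuple_sum g n C (coord_value g T (Const eta8 \<cdot>\<^sub>v v)) =
      tuple_sum g n C (\<lambda>i a. Const eta8 * coord_value g T v i a)"
    using v by (intro tuple_sum_cong)
      (auto simp: coord_value_def coord_var_def dest: lex_vec_lex_pos(2))
  also have "\<dots> = tuple_sum g n C (coord_value g T v)"
    by (simp only: tuple_sum_scale eta8_power Const.hom_one mult_1 flip: Const.hom_power)
  finally show "tuple_sum g n C (coord_value g T (map_mat Const (eta8 \<cdot>\<^sub>m 1\<^sub>m (2 ^ (g + 1))) *\<^sub>v v)) =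
      tuple_sum g n C (coord_value g T v)" unfolding e .
qed

lemma preserves_gens: "g \<ge> 1 \<Longrightarrow> \<tau> \<in> G_gens g \<Longrightarrow> preserves g T \<tau>"
  unfolding G_gens_def
  using preserves_T preserves_E preserves_M preserves_eta8 by blast

lemma preserves_one: "preserves g T (1\<^sub>m (2 ^ (g + 1)))"
  by (simp add: preserves_def Const.mat_hom_one del: power_Suc)

lemma preserves_mult:
  assumes "A \<in> carrier_mat (2 ^ (g + 1)) (2 ^ (g + 1))" "B \<in> carrier_mat (2 ^ (g + 1)) (2 ^ (g + 1))"
    and "preserves g T A" "preserves g T B"
  shows "preserves g T (A * B)"
  unfolding preserves_def
proof
  fix v :: "jpoly vec" assume v: "v \<in> carrier_vec (2 ^ (g + 1))"
  then have "map_mat Const B *\<^sub>v v \<in> carrier_vec (2 ^ (g + 1))"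
    using assms(2) by (intro mult_mat_vec_carrier) auto
  with v assms(3,4) show "tuple_sum g n C (coord_value g T (map_mat Const (A * B) *\<^sub>v v)) =
      tuple_sum g n C (coord_value g T v)"
    unfolding map_mat_Const_mult_vec[OF assms(1,2) v] preserves_def by metis
qed

text \<open>Invariance under \<open>A\<close> at the vector \<open>B *\<^sub>v v\<close> compares
  the value there with the value at \<open>v\<close> itself.\<close>

lemma preserves_inverse:
  assumes A: "A \<in> carrier_mat (2 ^ (g + 1)) (2 ^ (g + 1))" and B: "B \<in> carrier_mat (2 ^ (g + 1)) (2 ^ (g + 1))"
    and AB: "A * B = 1\<^sub>m (2 ^ (g + 1))" and pA: "preserves g T A"
  shows "preserves g T B"
  unfolding preserves_def
proof
  fix v :: "jpoly vec" assume v: "v \<in> carrier_vec (2 ^ (g + 1))"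
  then have "map_mat Const B *\<^sub>v v \<in> carrier_vec (2 ^ (g + 1))"
    using B by (intro mult_mat_vec_carrier) auto
  then have "tuple_sum g n C (coord_value g T (map_mat Const B *\<^sub>v v)) =
      tuple_sum g n C (coord_value g T (map_mat Const (A * B) *\<^sub>v v))"
    using pA unfolding map_mat_Const_mult_vec[OF A B v] preserves_def by metis
  also have "\<dots> = tuple_sum g n C (coord_value g T v)"
    using preserves_one[of g T] v unfolding AB preserves_def by metis
  finally show "tuple_sum g n C (coord_value g T (map_mat Const B *\<^sub>v v)) =
      tuple_sum g n C (coord_value g T v)" .
qed

lemma preserves_G_group:
  assumes g: "g \<ge> 1" and "\<tau> \<in> G_group g"
  shows "preserves g T \<tau>"
proof -
  let ?G = "GL TYPE(complex) (2 ^ (g + 1))"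
  interpret group ?G by (rule group_GL)
  from assms(2) show ?thesis
    unfolding G_group_def
  proof (induction rule: generate.induct)
    case one
    show ?case unfolding one_GL by (rule preserves_one)
  next
    case (incl h)
    then show ?case by (rule preserves_gens[OF g])
  next
    case (inv h)
    have h: "h \<in> carrier ?G" using inv G_gens_GL by blast
    show ?case
    proof (rule preserves_inverse)
      show "h * inv\<^bsub>?G\<^esub> h = 1\<^sub>m (2 ^ (g + 1))"
        using r_inv[OF h] unfolding mult_GL one_GL .
      show "preserves g T h" using inv by (rule preserves_gens[OF g])
    qed (rule GL_D[OF h], rule GL_D[OF inv_closed[OF h]])
  next
    case (eng h1 h2)
    then have "h1 \<in> carrier ?G" "h2 \<in> carrier ?G"
      using generate_in_carrier[OF G_gens_GL] by blast+
    with eng show ?case unfolding mult_GL by (intro preserves_mult GL_D)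
  qed
qed

end

theorem theorem5p4:
  fixes g n :: nat and C :: "bit vec set" and T :: "nat set" and \<tau> :: "complex mat"
  assumes "g \<ge> 1"
    and "type_II_code n C"
    and "T \<subseteq> {..<n}"
    and "\<tau> \<in> G_group g"
  shows "act g \<tau> (jacobi_poly g n C T) = jacobi_poly g n C T"
proof -
  interpret type_II n C
    by unfold_locales (use assms(2) in \<open>auto simp: type_II_code_def\<close>)
  \<comment> \<open>Invariance is used at the vector of the variables.\<close>
  have "act g \<tau> (jacobi_poly g n C T) = tuple_sum g n C (coord_value g T (var_vec g))"
    unfolding act_jacobi_poly[OF assms(3)]
    using preserves_G_group[OF assms(1,4)] var_vec_carrier by (simp add: preserves_def)
  also have "\<dots> = jacobi_poly g n C T"
    unfolding jacobi_poly_tuple_sum[OF assms(3)] by (rule tuple_sum_cong) (rule coord_value_var_vec)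
  finally show ?thesis .
qed

end
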